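(* Let $L,R\ge 0$ be integers (not both zero) and let $[\mathcal{D}_x]$ be the discrete differential operator with stencil $(L,R)$ and optimal order of accuracy $L+R$, with nodal coefficients $\beta_k$, $-l'\le k\le r'$, and let $H(\theta)=\sum_{k=-l'}^{r'}\beta_k e^{ik\theta}$. If $\mathrm{Re}\,H(\theta)>0$ for all $0<\theta\le\pi$, then $$L-R<\min\left(2R+7,\ 9+\sqrt{21R+49}\right).$$
   Context: Uniform grid $x_j=jh$, $h>0$. For a function $u$ write $u_j=u(x_j)$ and $\overline{u}_{j+1/2}=\frac1h\int_{x_j}^{x_{j+1}}u(x)\,dx$. Stencil. A pair $(L,R)$ of non-negative integers determines $l'=\lfloor L/2\rfloor$, $l=L-l'$, $r'=\lfloor R/2\rfloor$, $r=R-r'$; equivalently the stencil is the quadruple $(l,r,l',r')$. A discrete differential operator (DDO) with this stencil is $$[\mathcal{D}_xu]_j=\frac1h\sum_{k=-l}^{r-1}\alpha_k\overline{u}_{j+k+1/2}+\frac1h\sum_{k=-l'}^{r'}\beta_k u_{j+k},$$ with real constants $\alpha_k,\beta_k$ independent of $h$ and $u$. It is $p$-th order accurate if for all sufficiently smooth $u$ one has $[\mathcal{D}_xu]_j=u_x(x_j)+c_p\,u^{(p+1)}(x_j)h^p+O(h^{p+1})$ for some constant $c_p\neq0$. For each stencil there is a unique DDO of the optimal order $p=l+r+l'+r'=L+R$ (known); "optimal accuracy" refers to this one. Its nodal coefficients are known to be $$\beta_0=2(\zeta_0^{l,r}+\zeta_0^{l',r'}),\qquad \beta_\nu=-\frac{2}{\nu}C^{l,r}_\nu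 C^{l',r'}_\nu\quad(-l'\le\nu\le r',\ \nu\ne0),$$ where $C^{m,n}_k=\frac{m!\,n!}{(m+k)!\,(n-k)!}$, $\zeta^{m,n}_k=H_{m+k}-H_{n-k}$, and $H_k=1+\frac12+\cdots+\frac1k$ is the $k$-th harmonic number ($H_0=0$). *)

theory Defs
  imports "HOL-Analysis.Analysis"
begin

text \<open>
  The stencil belonging to a pair \<open>(L, R)\<close>: cell averages on the cells \<open>-l, \<dots>, r - 1\<close> and nodal
  values at the nodes \<open>-l', \<dots>, r'\<close>, where \<open>l\<close>, \<open>r\<close> are the \<open>cell_width\<close> and \<open>l'\<close>, \<open>r'\<close> the \<open>nodal_width\<close>
  of \<open>L\<close>, \<open>R\<close>; they are integers because they bound ranges of signed offsets.
\<close>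

definition nodal_width :: "nat \<Rightarrow> int" where
  "nodal_width n = \<lfloor>real n / 2\<rfloor>"

definition cell_width :: "nat \<Rightarrow> int" where
  "cell_width n = int n - nodal_width n"

definition grid :: "real \<Rightarrow> int \<Rightarrow> real" where
  "grid h j = of_int j * h"

text \<open>\<open>cell_average u h j\<close> is the average over \<open>[x\<^sub>j, x\<^sub>j\<^sub>+\<^sub>1]\<close>, the cell with midpoint index \<open>j + 1/2\<close>.\<close>

definition cell_average :: "(real \<Rightarrow> real) \<Rightarrow> real \<Rightarrow> int \<Rightarrow> real" where
  "cell_average u h j = 1 / h * integral {grid h j..grid h (j + 1)} u"

text \<open>
  The operator is given by its coefficients \<open>\<alpha>\<close> (cell averages) and \<open>\<beta>\<close> (nodal values); only the
  coefficients with offsets in the stencil are used.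
\<close>

definition ddo ::
  "nat \<Rightarrow> nat \<Rightarrow> (int \<Rightarrow> real) \<Rightarrow> (int \<Rightarrow> real) \<Rightarrow> real \<Rightarrow> (real \<Rightarrow> real) \<Rightarrow> int \<Rightarrow> real" where
  "ddo L R \<alpha> \<beta> h u j =
     1 / h * (\<Sum>k = - cell_width L..cell_width R - 1. \<alpha> k * cell_average u h (j + k)) +
     1 / h * (\<Sum>k = - nodal_width L..nodal_width R. \<beta> k * u (grid h (j + k)))"

definition continuously_diff :: "nat \<Rightarrow> (real \<Rightarrow> real) \<Rightarrow> bool" where
  "continuously_diff N u \<longleftrightarrow>
     (\<forall>i<N. (deriv ^^ i) u differentiable_on UNIV) \<and> continuous_on UNIV ((deriv ^^ N) u)"

text \<open>
  Accuracy of order \<open>p\<close>: for \<open>u\<close> of class \<open>C\<^sup>N\<close>, with \<open>N\<close> large enough, the error at \<open>x\<^sub>j\<close> is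
  \<open>c u\<^bsup>(p+1)\<^esup>(x\<^sub>j) h\<^sup>p + O(h\<^bsup>p+1\<^esup>)\<close>, where \<open>c\<close> depends neither on \<open>u\<close> nor on the grid.  The \<open>O\<close> is for
  \<open>h \<rightarrow> 0+\<close>, uniformly over the grid points in a bounded interval; this covers in particular a
  fixed index \<open>j\<close> as well as a fixed position \<open>x = x\<^sub>j\<close> with \<open>j = x/h\<close>.
\<close>

definition order_accurate ::
  "nat \<Rightarrow> nat \<Rightarrow> (int \<Rightarrow> real) \<Rightarrow> (int \<Rightarrow> real) \<Rightarrow> nat \<Rightarrow> bool" where
  "order_accurate L R \<alpha> \<beta> p \<longleftrightarrow>
     (\<exists>c N. c \<noteq> 0 \<and>
       (\<forall>u. continuously_diff N u \<longrightarrow>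
         (\<forall>M. \<exists>K. \<forall>\<^sub>F h in at_right 0. \<forall>j. \<bar>grid h j\<bar> \<le> M \<longrightarrow>
           \<bar>ddo L R \<alpha> \<beta> h u j - deriv u (grid h j)
              - c * (deriv ^^ (p + 1)) u (grid h j) * h ^ p\<bar> \<le> K * h ^ (p + 1))))"

text \<open>The symbol \<open>H(\<theta>)\<close> of the nodal part.\<close>

definition nodal_symbol :: "nat \<Rightarrow> nat \<Rightarrow> (int \<Rightarrow> real) \<Rightarrow> real \<Rightarrow> complex" where
  "nodal_symbol L R \<beta> \<theta> =
     (\<Sum>k = - nodal_width L..nodal_width R.
        complex_of_real (\<beta> k) * exp (\<i> * of_int k * complex_of_real \<theta>))"

end

theory Submission
  imports Defs "HOL-Computational_Algebra.Polynomial"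
begin

text \<open>
  An operator of order \<open>L + R\<close> is exact on polynomials of degree at most \<open>L + R\<close>; inserting the
  derivative of a polynomial that vanishes at all cell end points and doubly at all nodes but \<open>x\<^sub>k\<close>
  isolates \<open>\<beta> k\<close>.  Integrating \<open>Re H(\<theta>)\<close> against \<open>1 - cos (\<nu> \<theta>)\<close> over \<open>[0, \<pi>]\<close> gives the necessary
  condition \<open>\<beta> \<nu> + \<beta> (- \<nu>) \<le> 2 \<beta> 0\<close>.  Its right-hand side grows like the logarithm of \<open>L / R\<close>,
  whereas \<open>\<beta> (- \<nu>)\<close> is \<open>2 / \<nu>\<close> times two quotients of factorials.  Already \<open>\<nu> = 1\<close> contradicts
  \<open>L \<ge> 3 R + 7\<close>.  If \<open>L\<close> is smaller but \<open>D = L - R \<ge> 9 + sqrt (21 R + 49)\<close>, the quotients of factorials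
  behave like Gaussians with their peak near \<open>\<nu> = D / 4\<close>, and there the condition fails.
\<close>

section \<open>Polynomials with prescribed integer roots\<close>

definition node_poly :: "int set \<Rightarrow> real poly" where
  "node_poly S = (\<Prod>k\<in>S. [:- of_int k, 1:])"

lemma poly_node_poly: "poly (node_poly S) x = (\<Prod>k\<in>S. x - of_int k)"
  by (simp add: node_poly_def poly_prod)

lemma poly_node_poly_eq_0:
  assumes "finite S" "k \<in> S"
  shows "poly (node_poly S) (of_int k) = 0"
  using assms by (auto simp: poly_node_poly prod_zero_iff)

lemma degree_node_poly: "degree (node_poly S) \<le> card S"
proof (cases "finite S")
  case True
  then show ?thesis
    unfolding node_poly_def
    using degree_prod_sum_le[of S "\<lambda>k. [:- real_of_int k, 1:]"] by simp
qed (simp add: node_poly_def)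

lemma node_poly_remove:
  assumes "finite S" "k \<in> S"
  shows "node_poly S = [:- of_int k, 1:] * node_poly (S - {k})"
  using assms by (simp add: node_poly_def prod.remove)

lemma poly_pderiv_node_poly_root:
  assumes "finite S" "k \<in> S"
  shows "poly (pderiv (node_poly S)) (of_int k) = poly (node_poly (S - {k})) (of_int k)"
  unfolding node_poly_remove[OF assms] pderiv_mult by (simp add: pderiv_pCons)

lemma poly_pderiv2_node_poly_root:
  assumes "finite S" "k \<in> S"
  shows "poly (pderiv (pderiv (node_poly S))) (of_int k) =
    2 * poly (pderiv (node_poly (S - {k}))) (of_int k)"
  unfolding node_poly_remove[OF assms] pderiv_mult pderiv_add by (simp add: pderiv_pCons)

text \<open>Logarithmic differentiation of a product of linear factors; \<open>x\<close> avoids the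
  roots, so all denominators are nonzero.\<close>

lemma poly_pderiv_node_poly:
  assumes "finite S" "\<And>k. k \<in> S \<Longrightarrow> x \<noteq> of_int k"
  shows "poly (pderiv (node_poly S)) x = poly (node_poly S) x * (\<Sum>k\<in>S. 1 / (x - of_int k))"
  using assms
proof (induction S rule: finite_induct)
  case (insert k S)
  have "node_poly (insert k S) = [:- of_int k, 1:] * node_poly S"
    using insert by (simp add: node_poly_def)
  then have "poly (pderiv (node_poly (insert k S))) x =
      poly (node_poly S) x + (x - of_int k) * (poly (node_poly S) x * (\<Sum>k\<in>S. 1 / (x - of_int k)))"
    using insert by (simp only: pderiv_mult poly_add poly_mult) (simp add: pderiv_pCons)
  also have "\<dots> = (x - of_int k) * poly (node_poly S) x * (1 / (x - of_int k) + (\<Sum>k\<in>S. 1 / (x - of_int k)))"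
    using insert.prems[of k] by (simp add: field_simps)
  finally show ?case
    using insert by (simp add: poly_node_poly)
qed (simp add: node_poly_def)

lemma symmetric_interval_split:
  fixes m n :: nat
  shows "{- int m..int n} - {0} = (\<lambda>i. - int i) ` {1..m} \<union> int ` {1..n}"
proof (intro equalityI subsetI)
  fix k assume k: "k \<in> {- int m..int n} - {0}"
  show "k \<in> (\<lambda>i. - int i) ` {1..m} \<union> int ` {1..n}"
  proof (cases "k > 0")
    case True
    then have "k = int (nat k)" "nat k \<in> {1..n}" using k by auto
    then show ?thesis by blast
  next
    case False
    then have "k = - int (nat (- k))" "nat (- k) \<in> {1..m}" using k by auto
    then show ?thesis by blast
  qed
qed auto

lemma prod_punctured_interval:
  fixes m n :: nat and f :: "int \<Rightarrow> 'a::comm_monoid_mult"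
  shows "(\<Prod>k\<in>{- int m..int n} - {0}. f k) = (\<Prod>i=1..m. f (- int i)) * (\<Prod>i=1..n. f (int i))"
proof -
  have "(\<lambda>i. - int i) ` {1..m} \<inter> int ` {1..n} = {}" by auto
  then show ?thesis
    unfolding symmetric_interval_split
    by (subst prod.union_disjoint) (auto simp: prod.reindex inj_on_def)
qed

lemma sum_punctured_interval:
  fixes m n :: nat and f :: "int \<Rightarrow> 'a::comm_monoid_add"
  shows "(\<Sum>k\<in>{- int m..int n} - {0}. f k) = (\<Sum>i=1..m. f (- int i)) + (\<Sum>i=1..n. f (int i))"
proof -
  have "(\<lambda>i. - int i) ` {1..m} \<inter> int ` {1..n} = {}" by auto
  then show ?thesis
    unfolding symmetric_interval_split
    by (subst sum.union_disjoint) (auto simp: sum.reindex inj_on_def)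
qed

lemma poly_node_poly_punctured_0:
  "poly (node_poly ({- int m..int n} - {0})) 0 = (- 1) ^ n * fact m * fact n"
  unfolding poly_node_poly prod_punctured_interval
  by (simp add: fact_prod prod_uminus flip: of_nat_prod)

lemma poly_node_poly_punctured:
  assumes "- int m \<le> k" "k \<le> int n"
  shows "poly (node_poly ({- int m..int n} - {k})) (of_int k) =
    (- 1) ^ nat (int n - k) * fact (nat (int m + k)) * fact (nat (int n - k))"
proof -
  \<comment> \<open>Translating by \<open>k\<close> moves the removed root to 0.\<close>
  let ?T = "{- int (nat (int m + k))..int (nat (int n - k))} - {0}"
  have "bij_betw (\<lambda>i. i + k) ?T ({- int m..int n} - {k})"
    by (rule bij_betwI[where g = "\<lambda>i. i - k"]) (use assms in auto)
  then have "poly (node_poly ({- int m..int n} - {k})) (of_int k) = poly (node_poly ?T) 0"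
    unfolding poly_node_poly by (subst prod.reindex_bij_betw[symmetric, of _ ?T]) auto
  then show ?thesis
    by (simp only: poly_node_poly_punctured_0)
qed

text \<open>In the logarithmic derivative at 0 the negative roots contribute \<open>harm m\<close>
  and the positive ones \<open>- harm n\<close>. This is the source of the harmonic numbers in
  \<open>\<beta> 0\<close>.\<close>

lemma pderiv_node_poly_punctured_0:
  "poly (pderiv (node_poly ({- int m..int n} - {0}))) 0 =
    poly (node_poly ({- int m..int n} - {0})) 0 * (harm m - harm n)"
proof -
  have "(\<Sum>k\<in>{- int m..int n} - {0}. 1 / (0 - real_of_int k)) = harm m - harm n"
    unfolding sum_punctured_interval by (simp add: harm_def field_simps sum_negf)
  then show ?thesis
    by (subst poly_pderiv_node_poly) auto
qed

section \<open>Exactness of an accurate operator on polynomials\<close>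

lemma deriv_poly: "deriv (poly p) = poly (pderiv (p :: real poly))"
  by (rule ext, rule DERIV_imp_deriv, rule poly_DERIV)

lemma funpow_deriv_poly: "(deriv ^^ i) (poly p) = poly ((pderiv ^^ i) (p :: real poly))"
  by (induction i) (simp_all add: deriv_poly)

lemma continuously_diff_poly: "continuously_diff N (poly p)"
  unfolding continuously_diff_def funpow_deriv_poly
  by (auto intro!: continuous_intros simp: differentiable_on_def poly_differentiable)

lemma degree_funpow_pderiv: "degree ((pderiv ^^ i) (p :: real poly)) = degree p - i"
  by (induction i) (simp_all add: degree_pderiv)

lemma funpow_pderiv_eq_0:
  assumes "degree (p :: real poly) \<le> n"
  shows "(pderiv ^^ Suc n) p = 0"
proof -
  have "degree ((pderiv ^^ n) p) = 0" using assms by (simp add: degree_funpow_pderiv)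
  then show ?thesis by (simp add: pderiv_eq_0_iff)
qed

lemma cell_average_poly_pderiv:
  assumes "h > 0"
  shows "cell_average (poly (pderiv w)) h k = (poly w (grid h (k + 1)) - poly w (grid h k)) / h"
proof -
  have "(poly (pderiv w) has_integral poly w (grid h (k + 1)) - poly w (grid h k))
      {grid h k..grid h (k + 1)}"
    using assms
    by (intro fundamental_theorem_of_calculus)
       (auto simp: grid_def algebra_simps simp flip: has_real_derivative_iff_has_vector_derivative
          intro!: DERIV_subset[OF poly_DERIV])
  then show ?thesis
    by (simp add: cell_average_def integral_unique)
qed

text \<open>Here \<open>w\<close> is an antiderivative of the function the operator is applied to, with \<open>h = 1\<close>.\<close>

definition ddo_primitive ::
  "nat \<Rightarrow> nat \<Rightarrow> (int \<Rightarrow> real) \<Rightarrow> (int \<Rightarrow> real) \<Rightarrow> real poly \<Rightarrow> real" where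
  "ddo_primitive L R \<alpha> \<beta> w =
     (\<Sum>k = - cell_width L..cell_width R - 1. \<alpha> k * (poly w (of_int (k + 1)) - poly w (of_int k))) +
     (\<Sum>k = - nodal_width L..nodal_width R. \<beta> k * poly (pderiv w) (of_int k))"

text \<open>On a grid through 0, cell averages and nodal values of a monomial of degree
  \<open>m\<close> both scale with \<open>h ^ m\<close>, so the step size factors out.\<close>

lemma ddo_monom:
  assumes "h > 0"
  shows "h * ddo L R \<alpha> \<beta> h (poly (pderiv (monom 1 (Suc m)))) 0 =
    ddo_primitive L R \<alpha> \<beta> (monom 1 (Suc m)) * h ^ m"
proof -
  have "cell_average (poly (pderiv (monom 1 (Suc m)))) h k =
      (poly (monom 1 (Suc m)) (of_int (k + 1)) - poly (monom 1 (Suc m)) (of_int k)) * h ^ m" for k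
    unfolding cell_average_poly_pderiv[OF assms] using assms
    by (simp add: grid_def poly_monom power_mult_distrib diff_divide_distrib left_diff_distrib del: of_int_add)
  moreover have "poly (pderiv (monom 1 (Suc m))) (grid h k) =
      poly (pderiv (monom 1 (Suc m))) (of_int k) * h ^ m" for k
    by (simp add: grid_def pderiv_monom poly_monom power_mult_distrib)
  ultimately show ?thesis
    using assms unfolding ddo_def ddo_primitive_def
    by (simp add: distrib_left distrib_right sum_distrib_right mult.assoc del: of_int_add)
qed

text \<open>At the grid point 0 the leading error term vanishes, because its derivative exceeds the
  degree. By homogeneity the remaining bound, divided by a power of \<open>h\<close>, has a
  left-hand side free of \<open>h\<close>; the limit \<open>h\<close> to 0 forces it to be
  0.\<close>

lemma order_accurate_monom:
  assumes "order_accurate L R \<alpha> \<beta> p" "m \<le> p"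
  shows "ddo_primitive L R \<alpha> \<beta> (monom 1 (Suc m)) = poly (pderiv (pderiv (monom 1 (Suc m)))) 0"
proof -
  let ?w = "monom (1 :: real) (Suc m)"
  let ?F = "ddo_primitive L R \<alpha> \<beta> ?w" and ?G = "poly (pderiv (pderiv ?w)) 0"
  obtain c N where cN: "\<And>u M. continuously_diff N u \<Longrightarrow>
      (\<exists>K. \<forall>\<^sub>F h in at_right 0. \<forall>j. \<bar>grid h j\<bar> \<le> M \<longrightarrow>
           \<bar>ddo L R \<alpha> \<beta> h u j - deriv u (grid h j)
              - c * (deriv ^^ (p + 1)) u (grid h j) * h ^ p\<bar> \<le> K * h ^ (p + 1))"
    using assms(1) unfolding order_accurate_def by blast
  have "degree (pderiv ?w) \<le> p"
    using assms(2) by (simp add: degree_pderiv degree_monom_eq)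
  then have zero: "(deriv ^^ (p + 1)) (poly (pderiv ?w)) = (\<lambda>_. 0)"
    unfolding funpow_deriv_poly by (simp only: Suc_eq_plus1[symmetric] funpow_pderiv_eq_0) auto
  obtain K where "\<forall>\<^sub>F h in at_right 0. \<forall>j. \<bar>grid h j\<bar> \<le> 0 \<longrightarrow>
      \<bar>ddo L R \<alpha> \<beta> h (poly (pderiv ?w)) j - deriv (poly (pderiv ?w)) (grid h j)
         - c * (deriv ^^ (p + 1)) (poly (pderiv ?w)) (grid h j) * h ^ p\<bar> \<le> K * h ^ (p + 1)"
    using cN[OF continuously_diff_poly] by blast
  then have ev: "\<forall>\<^sub>F h in at_right 0. \<bar>ddo L R \<alpha> \<beta> h (poly (pderiv ?w)) 0 - ?G\<bar> \<le> K * h ^ (p + 1)"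
    unfolding zero deriv_poly by eventually_elim (auto simp: grid_def)
  \<comment> \<open>For \<open>m = 1\<close> both powers agree; for every other \<open>m\<close> the
    second derivative at 0 is 0.\<close>
  have G: "?G * h = ?G * h ^ m" for h :: real
    by (cases "m = 1") (auto simp: pderiv_monom poly_monom)
  have "\<forall>\<^sub>F h in at_right 0. \<bar>?F - ?G\<bar> \<le> K * h ^ (p + 2 - m)"
    using ev eventually_at_right_less[of 0]
  proof eventually_elim
    case (elim h)
    let ?d = "ddo L R \<alpha> \<beta> h (poly (pderiv ?w)) 0"
    have "\<bar>?F - ?G\<bar> * h ^ m = \<bar>(?F - ?G) * h ^ m\<bar>"
      using elim by (simp add: abs_mult)
    also have "(?F - ?G) * h ^ m = h * (?d - ?G)"
      using ddo_monom[OF elim(2), of L R \<alpha> \<beta> m] G[of h] by (simp add: algebra_simps)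
    also have "\<bar>h * (?d - ?G)\<bar> \<le> h * (K * h ^ (p + 1))"
      using elim by (simp add: abs_mult del: power_Suc)
    also have "\<dots> = K * h ^ (p + 2 - m) * h ^ m"
      using assms(2) by (simp flip: power_add power_Suc)
    finally show ?case
      using elim by simp
  qed
  \<comment> \<open>The exponent is at least 2 because \<open>m \<le> p\<close>, so this limit is
    0.\<close>
  moreover have "((\<lambda>h::real. K * h ^ (p + 2 - m)) \<longlongrightarrow> K * 0 ^ (p + 2 - m)) (at_right 0)"
    by (intro tendsto_intros)
  ultimately have "\<bar>?F - ?G\<bar> \<le> K * 0 ^ (p + 2 - m)"
    by (intro tendsto_lowerbound) auto
  then show ?thesis
    using assms(2) by (simp add: power_0_left)
qed

text \<open>Both sides are linear in \<open>w\<close>, which reduces the claim to monomials; a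
  constant \<open>w\<close> contributes 0 to either side.\<close>

lemma order_accurate_exact:
  assumes "order_accurate L R \<alpha> \<beta> p" "degree w \<le> p + 1"
  shows "ddo_primitive L R \<alpha> \<beta> w = poly (pderiv (pderiv w)) 0"
proof -
  let ?D = "\<lambda>w. ddo_primitive L R \<alpha> \<beta> w - poly (pderiv (pderiv w)) 0"
  have add: "?D (v + w) = ?D v + ?D w" for v w
    by (simp add: ddo_primitive_def pderiv_add distrib_left sum.distrib sum_subtractf algebra_simps)
  have smult: "?D (smult a w) = a * ?D w" for a w
    by (simp add: ddo_primitive_def pderiv_smult sum_distrib_left algebra_simps sum_subtractf)
  have monom: "?D (monom a i) = 0" if "i \<le> p + 1" for a i
  proof -
    have "?D (monom 1 i) = 0"
    proof (cases i)
      case 0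
      then show ?thesis by (simp add: ddo_primitive_def monom_0 pderiv_pCons)
    next
      case (Suc m)
      then show ?thesis using order_accurate_monom[OF assms(1), of m] that by simp
    qed
    then show ?thesis using smult[of a "monom 1 i"] by (simp add: smult_monom)
  qed
  have "?D (\<Sum>i\<le>n. monom (coeff w i) i) = 0" if "n \<le> p + 1" for n
    using that by (induction n) (use monom in \<open>simp_all only: sum.atMost_Suc add, auto\<close>)
  then show ?thesis
    using assms(2) poly_as_sum_of_monoms[of w] by (metis eq_iff_diff_eq_0)
qed

section \<open>Estimates for logarithms and harmonic numbers\<close>

text \<open>This is the midpoint rule for the convex function \<open>1 / x\<close> on the interval
  from \<open>a\<close> to \<open>b\<close>, which underestimates the integral.\<close>

lemma ln_divide_ge:
  fixes a b :: real
  assumes "0 < a" "a \<le> b"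
  shows "2 * (b - a) / (a + b) \<le> ln (b / a)"
proof -
  let ?f = "\<lambda>x. ln x - ln a - 2 * (x - a) / (a + x)"
  have deriv: "\<exists>y. (?f has_real_derivative y) (at x) \<and> 0 \<le> y" if "a \<le> x" for x
  proof (intro exI conjI)
    have x: "x > 0" "a + x \<noteq> 0" using assms that by auto
    have "(?f has_real_derivative 1 / x - (2 * (a + x) - 2 * (x - a)) / ((a + x) * (a + x))) (at x)"
      using x by (auto intro!: derivative_eq_intros)
    also have "1 / x - (2 * (a + x) - 2 * (x - a)) / ((a + x) * (a + x)) = (x - a)\<^sup>2 / (x * (a + x)\<^sup>2)"
      using x by (simp add: divide_simps) (simp add: power2_eq_square algebra_simps)
    finally show "(?f has_real_derivative (x - a)\<^sup>2 / (x * (a + x)\<^sup>2)) (at x)" .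
    show "0 \<le> (x - a)\<^sup>2 / (x * (a + x)\<^sup>2)" using x by simp
  qed
  have "?f a \<le> ?f b"
    by (rule DERIV_nonneg_imp_nondecreasing[of a b ?f]) (fact assms(2), rule deriv)
  then show ?thesis
    using assms by (simp add: ln_div)
qed

text \<open>Each term \<open>1 / (m + 1)\<close> is the midpoint value of \<open>1 / x\<close>
  between \<open>m + 1 / 2\<close> and \<open>m + 3 / 2\<close>; the logarithms telescope.\<close>

lemma harm_diff_le_ln:
  assumes "n \<le> m"
  shows "harm m - harm n \<le> ln ((real m + 1 / 2) / (real n + 1 / 2))"
  using assms
proof (induction m rule: dec_induct)
  case (step m)
  have "1 / (real m + 1) \<le> ln ((real m + 3 / 2) / (real m + 1 / 2))"
    using ln_divide_ge[of "real m + 1 / 2" "real m + 3 / 2"] by (simp add: field_simps)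
  also have "\<dots> = ln (real m + 3 / 2) - ln (real m + 1 / 2)"
    by (simp add: ln_div)
  finally show ?case
    using step by (simp add: harm_Suc ln_div inverse_eq_divide add.commute)
qed simp

text \<open>There are \<open>m - n\<close> terms, each at most \<open>1 / (n + 1)\<close>. Cruder
  than the logarithmic bound, but rational.\<close>

lemma harm_diff_le_divide:
  assumes "n \<le> m"
  shows "harm m - harm n \<le> (real m - real n) / (real n + 1)"
  using assms
proof (induction m rule: dec_induct)
  case (step m)
  have "1 / (1 + real m) \<le> 1 / (real n + 1)"
    using step by (intro divide_left_mono) auto
  then show ?case
    using step by (simp add: harm_Suc inverse_eq_divide add_divide_distrib diff_divide_distrib)
qed simp

section \<open>Quotients of factorials\<close>

text \<open>The coefficient \<open>C\<^sup>m\<^sup>,\<^sup>n\<^sub>k\<close> of the paper; its value is meaningful only for \<open>- m \<le> k \<le> n\<close>.\<close>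

definition node_ratio :: "nat \<Rightarrow> nat \<Rightarrow> int \<Rightarrow> real" where
  "node_ratio m n k = fact m * fact n / (fact (nat (int m + k)) * fact (nat (int n - k)))"

lemma node_ratio_0: "node_ratio m n 0 = 1"
  by (simp add: node_ratio_def)

lemma node_ratio_minus_Suc:
  assumes "k < m"
  shows "node_ratio m n (- int (Suc k)) =
    node_ratio m n (- int k) * ((real m - real k) / (real n + real k + 1))"
proof -
  have "nat (int m + - int (Suc k)) = m - Suc k" "nat (int m + - int k) = Suc (m - Suc k)"
    "nat (int n - - int (Suc k)) = Suc (n + k)" "nat (int n - - int k) = n + k"
    using assms by auto
  then show ?thesis
    using assms by (simp only: node_ratio_def) (simp add: of_nat_diff divide_simps)
qed

lemma node_ratio_Suc:
  assumes "k < n"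
  shows "node_ratio m n (int (Suc k)) =
    node_ratio m n (int k) * ((real n - real k) / (real m + real k + 1))"
proof -
  have "nat (int m + int (Suc k)) = Suc (m + k)" "nat (int m + int k) = m + k"
    "nat (int n - int (Suc k)) = n - Suc k" "nat (int n - int k) = Suc (n - Suc k)"
    using assms by auto
  then show ?thesis
    using assms by (simp only: node_ratio_def) (simp add: of_nat_diff divide_simps)
qed

lemma node_ratio_nonneg: "0 \<le> node_ratio m n k"
  by (simp add: node_ratio_def)

text \<open>For \<open>n \<le> m\<close> every factor of the recursion in the positive direction is
  at most 1.\<close>

lemma node_ratio_le_1:
  assumes "n \<le> m" "k \<le> n"
  shows "node_ratio m n (int k) \<le> 1"
  using assms(2)
proof (induction k)
  case (Suc k)
  have "(real n - real k) / (real m + real k + 1) \<le> 1"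
    using assms(1) by simp
  then have "node_ratio m n (int k) * ((real n - real k) / (real m + real k + 1)) \<le> 1 * 1"
    using Suc by (intro mult_mono) auto
  then show ?case
    using Suc node_ratio_Suc[of k n m] by simp
qed (simp add: node_ratio_0)

text \<open>By \<open>ln_divide_ge\<close> the logarithms of the factors dominate an arithmetic
  progression, whose sum is the quadratic exponent. The hypothesis makes every factor at least
  1.\<close>

lemma node_ratio_minus_ge_exp:
  assumes "n + 2 * k \<le> m + 1"
  shows "exp (2 * real k * (real m - real n - real k) / (real m + real n + 1)) \<le> node_ratio m n (- int k)"
  using assms
proof (induction k)
  case (Suc k)
  let ?s = "real m + real n + 1"
  let ?q = "(real m - real k) / (real n + real k + 1)"
  have "2 * (real m - real n - 2 * real k - 1) / ?s \<le> ln ?q"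
    using ln_divide_ge[of "real n + real k + 1" "real m - real k"] Suc.prems
    by (simp add: algebra_simps)
  then have q: "exp (2 * (real m - real n - 2 * real k - 1) / ?s) \<le> ?q"
    using Suc.prems by (subst (asm) ln_ge_iff) auto
  have "2 * real (Suc k) * (real m - real n - real (Suc k)) / ?s =
      2 * real k * (real m - real n - real k) / ?s + 2 * (real m - real n - 2 * real k - 1) / ?s"
    unfolding add_divide_distrib[symmetric] by (simp add: algebra_simps)
  then have "exp (2 * real (Suc k) * (real m - real n - real (Suc k)) / ?s) \<le> node_ratio m n (- int k) * ?q"
    using Suc q by (simp only: exp_add) (intro mult_mono, auto simp: node_ratio_nonneg)
  then show ?case
    using Suc.prems node_ratio_minus_Suc[of k m n] by simp
qed (simp add: node_ratio_0)

section \<open>A necessary condition from integrating the symbol\<close>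

lemma int_cos_has_integral:
  "((\<lambda>t. cos (of_int k * t)) has_integral (if k = 0 then pi else 0)) {0..pi}"
proof (cases "k = 0")
  case True
  then show ?thesis using has_integral_const_real[of "1::real" 0 pi] by simp
next
  case False
  have "((\<lambda>t. cos (of_int k * t)) has_integral
      sin (of_int k * pi) / of_int k - sin (of_int k * 0) / of_int k) {0..pi}"
    using False by (intro fundamental_theorem_of_calculus)
      (auto simp flip: has_real_derivative_iff_has_vector_derivative intro!: derivative_eq_intros)
  then show ?thesis using False by (simp add: sin_int_times_real mult.commute)
qed

text \<open>By the product-to-sum formula, the weight extracts from a trigonometric sum exactly the
  coefficients at 0 and at plus or minus \<open>\<nu>\<close>.\<close>

lemma cos_times_one_minus_cos_has_integral:
  assumes "\<nu> \<noteq> 0"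
  shows "((\<lambda>t. cos (of_int k * t) * (1 - cos (of_int \<nu> * t))) has_integral
    (if k = 0 then pi else if k = \<nu> \<or> k = - \<nu> then - (pi / 2) else 0)) {0..pi}"
proof -
  have eq: "cos (of_int k * t) * (1 - cos (of_int \<nu> * t)) =
      cos (of_int k * t) - (cos (of_int (k - \<nu>) * t) + cos (of_int (k + \<nu>) * t)) * (1 / 2)" for t :: real
    using cos_times_cos[of "of_int k * t" "of_int \<nu> * t"]
    unfolding of_int_diff of_int_add left_diff_distrib[of _ _ t] distrib_right[of _ _ t] right_diff_distrib
    by linarith
  have "((\<lambda>t. cos (of_int k * t) * (1 - cos (of_int \<nu> * t))) has_integral
      (if k = 0 then pi else 0) - ((if k - \<nu> = 0 then pi else 0) + (if k + \<nu> = 0 then pi else 0)) * (1 / 2)) {0..pi}"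
    unfolding eq
    by (intro has_integral_diff has_integral_add has_integral_mult_left int_cos_has_integral)
  moreover have "(if k = 0 then pi else 0) - ((if k - \<nu> = 0 then pi else 0) + (if k + \<nu> = 0 then pi else 0)) * (1 / 2)
     = (if k = 0 then pi else if k = \<nu> \<or> k = - \<nu> then - (pi / 2) else 0)"
    using assms by auto
  ultimately show ?thesis by simp
qed

lemma Re_nodal_symbol:
  "Re (nodal_symbol L R \<beta> t) = (\<Sum>k = - nodal_width L..nodal_width R. \<beta> k * cos (of_int k * t))"
  unfolding nodal_symbol_def by (simp add: Re_exp mult.assoc)

text \<open>The weight \<open>1 - cos (\<nu> t)\<close> is nonnegative, hence so is the integral of
  its product with the symbol. The conditional covers a node \<open>\<nu>\<close> outside the
  stencil.\<close>

lemma nodal_symbol_pos_imp: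
  assumes "\<And>t. 0 < t \<Longrightarrow> t \<le> pi \<Longrightarrow> Re (nodal_symbol L R \<beta> t) > 0"
    and \<nu>: "0 < \<nu>" "\<nu> \<le> nodal_width L"
    and "0 \<le> nodal_width R"
  shows "\<beta> (- \<nu>) + (if \<nu> \<le> nodal_width R then \<beta> \<nu> else 0) \<le> 2 * \<beta> 0"
proof -
  let ?I = "{- nodal_width L..nodal_width R}"
  let ?c = "\<lambda>k. if k = 0 then pi else if k = \<nu> \<or> k = - \<nu> then - (pi / 2) else 0"
  have "((\<lambda>t. \<Sum>k\<in>?I. \<beta> k * (cos (of_int k * t) * (1 - cos (of_int \<nu> * t)))) has_integral
      (\<Sum>k\<in>?I. \<beta> k * ?c k)) {0..pi}"
    using \<nu> by (intro has_integral_sum has_integral_mult_right cos_times_one_minus_cos_has_integral) auto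
  moreover have "0 \<le> (\<Sum>k\<in>?I. \<beta> k * (cos (of_int k * t) * (1 - cos (of_int \<nu> * t))))" if "t \<in> {0..pi}" for t
  proof -
    have "0 \<le> Re (nodal_symbol L R \<beta> t) * (1 - cos (of_int \<nu> * t))"
      \<comment> \<open>Positivity is assumed for \<open>t > 0\<close> only; at \<open>t = 0\<close>
        the weight vanishes.\<close>
      using assms(1)[of t] that by (cases "t = 0") auto
    then show ?thesis by (simp add: Re_nodal_symbol sum_distrib_right mult.assoc)
  qed
  ultimately have "0 \<le> (\<Sum>k\<in>?I. \<beta> k * ?c k)"
    by (rule has_integral_nonneg)
  \<comment> \<open>The summand is split into three single-index terms, so that each sum
    collapses.\<close>
  also have "(\<Sum>k\<in>?I. \<beta> k * ?c k) = (\<Sum>k\<in>?I. (if k = 0 then pi * \<beta> 0 else 0)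
       + (if k = \<nu> then - (pi / 2) * \<beta> \<nu> else 0) + (if k = - \<nu> then - (pi / 2) * \<beta> (- \<nu>) else 0))"
    using \<nu> by (intro sum.cong) auto
  also have "\<dots> = pi * \<beta> 0 + (if \<nu> \<le> nodal_width R then - (pi / 2) * \<beta> \<nu> else 0) - (pi / 2) * \<beta> (- \<nu>)"
    using \<nu> assms(4) by (simp add: sum.distrib)
  also have "\<dots> = (pi / 2) * (2 * \<beta> 0 - (if \<nu> \<le> nodal_width R then \<beta> \<nu> else 0) - \<beta> (- \<nu>))"
    by (simp add: algebra_simps)
  finally have "0 \<le> 2 * \<beta> 0 - (if \<nu> \<le> nodal_width R then \<beta> \<nu> else 0) - \<beta> (- \<nu>)"
    by (metis mult_le_cancel_left_pos mult_zero_right pi_half_gt_zero)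
  then show ?thesis by linarith
qed

section \<open>Closed formulas for the nodal coefficients\<close>

lemma nodal_width_eq: "nodal_width n = int (n div 2)"
  using floor_divide_of_nat_eq[of n 2, where ?'a = real] by (simp add: nodal_width_def)

lemma cell_width_eq: "cell_width n = int (n - n div 2)"
  by (simp add: cell_width_def nodal_width_eq of_nat_diff)

text \<open>
  The antiderivative \<open>w\<close> vanishes at all end points of the cells and has double zeros at all nodes
  except \<open>k\<close>, so that only the coefficient \<open>\<beta> k\<close> contributes when the operator is applied to \<open>w'\<close>.
\<close>

lemma nodal_coeff_node_poly:
  fixes L R :: nat
  defines "I \<equiv> {- int (L - L div 2)..int (R - R div 2)}"
    and "J \<equiv> {- int (L div 2)..int (R div 2)}"
  assumes "order_accurate L R \<alpha> \<beta> (L + R)" "k \<in> J"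
  shows "\<beta> k * (poly (node_poly (I - {k})) (of_int k) * poly (node_poly (J - {k})) (of_int k)) =
    poly (pderiv (pderiv (node_poly I * node_poly (J - {k})))) 0"
proof -
  define w where "w = node_poly I * node_poly (J - {k})"
  have fin: "finite I" "finite J" and sub: "J \<subseteq> I"
    by (auto simp: I_def J_def)
  \<comment> \<open>The degree may exceed the order by one, since the operator acts on the
    derivative of \<open>w\<close>.\<close>
  have "degree w \<le> card I + card (J - {k})"
    unfolding w_def by (intro order.trans[OF degree_mult_le] add_mono degree_node_poly)
  also have "\<dots> = L + R + 1"
    using assms(4) by (simp add: card_Diff_singleton I_def J_def)
  finally have "ddo_primitive L R \<alpha> \<beta> w = poly (pderiv (pderiv w)) 0"
    by (rule order_accurate_exact[OF assms(3)])
  moreover have "poly w (of_int i) = 0" if "i \<in> I" for i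
    using poly_node_poly_eq_0[OF fin(1) that] by (simp add: w_def)
  then have "(\<Sum>i = - cell_width L..cell_width R - 1.
      \<alpha> i * (poly w (of_int (i + 1)) - poly w (of_int i))) = 0"
    by (intro sum.neutral) (auto simp: I_def cell_width_eq simp del: of_int_add)
  \<comment> \<open>Both factors of \<open>w\<close> vanish at such a node, which makes the zero
    double.\<close>
  moreover have "poly (pderiv w) (of_int i) = 0" if "i \<in> J - {k}" for i
    using poly_node_poly_eq_0[of I i] poly_node_poly_eq_0[of "J - {k}" i] fin sub that
    by (auto simp: w_def pderiv_mult)
  then have "(\<Sum>i = - nodal_width L..nodal_width R. \<beta> i * poly (pderiv w) (of_int i)) =
      \<beta> k * poly (pderiv w) (of_int k)"
    using fin assms(4) unfolding nodal_width_eq J_def[symmetric]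
    by (subst sum.remove[of J k]) auto
  moreover have "poly (pderiv w) (of_int k) =
      poly (node_poly (I - {k})) (of_int k) * poly (node_poly (J - {k})) (of_int k)"
    using poly_node_poly_eq_0[of I k] poly_pderiv_node_poly_root[of I k] fin sub assms(4)
    by (auto simp: w_def pderiv_mult)
  ultimately show ?thesis
    by (simp add: ddo_primitive_def w_def)
qed

text \<open>With \<open>P = node_poly I\<close> vanishing at 0 and
  \<open>Q = node_poly (J - {0})\<close>, the second derivative of \<open>P * Q\<close> at 0 is
  \<open>P'' Q + 2 P' Q'\<close>. Dividing by \<open>a * b\<close>, that is \<open>P' Q\<close>,
  leaves twice a sum of logarithmic derivatives.\<close>

lemma nodal_coeff_0:
  assumes "order_accurate L R \<alpha> \<beta> (L + R)"
  shows "\<beta> 0 = 2 * (harm (L - L div 2) - harm (R - R div 2) + (harm (L div 2) - harm (R div 2)))"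
proof -
  define I where "I = {- int (L - L div 2)..int (R - R div 2)}"
  define J where "J = {- int (L div 2)..int (R div 2)}"
  define a where "a = poly (node_poly (I - {0})) 0"
  define b where "b = poly (node_poly (J - {0})) 0"
  have I: "finite I" "0 \<in> I" and J: "finite J" "0 \<in> J"
    by (auto simp: I_def J_def)
  have ab: "a \<noteq> 0" "b \<noteq> 0"
    unfolding a_def b_def I_def J_def poly_node_poly_punctured_0 by auto
  have P: "poly (pderiv (node_poly I)) 0 = a"
    "poly (pderiv (pderiv (node_poly I))) 0 = 2 * (a * (harm (L - L div 2) - harm (R - R div 2)))"
    using poly_pderiv_node_poly_root[OF I] poly_pderiv2_node_poly_root[OF I]
    by (simp_all only: of_int_0 a_def I_def pderiv_node_poly_punctured_0)
  have Q: "poly (pderiv (node_poly (J - {0}))) 0 = b * (harm (L div 2) - harm (R div 2))"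
    by (simp only: b_def J_def pderiv_node_poly_punctured_0)
  have "\<beta> 0 * (a * b) = poly (pderiv (pderiv (node_poly I * node_poly (J - {0})))) 0"
    using nodal_coeff_node_poly[OF assms, of 0] J by (simp add: I_def J_def a_def b_def)
  also have "\<dots> = poly (pderiv (pderiv (node_poly I))) 0 * b
      + 2 * (poly (pderiv (node_poly I)) 0 * poly (pderiv (node_poly (J - {0}))) 0)"
    using poly_node_poly_eq_0[OF I] by (simp add: pderiv_mult pderiv_add b_def)
  also have "\<dots> = 2 * (a * (harm (L - L div 2) - harm (R - R div 2))) * b
      + 2 * (a * (b * (harm (L div 2) - harm (R div 2))))"
    by (simp only: P Q)
  also have "\<dots> = 2 * (harm (L - L div 2) - harm (R - R div 2) + (harm (L div 2) - harm (R div 2))) * (a * b)"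
    by (simp add: algebra_simps)
  finally show ?thesis using ab by simp
qed

text \<open>For \<open>k\<close> other than 0 both factors of \<open>w\<close> have a simple zero at
  0, so only twice the product of their first derivatives survives.\<close>

lemma nodal_coeff_nonzero:
  assumes "order_accurate L R \<alpha> \<beta> (L + R)"
    and k: "k \<noteq> 0" "- int (L div 2) \<le> k" "k \<le> int (R div 2)"
  shows "\<beta> k = - 2 / of_int k * (node_ratio (L - L div 2) (R - R div 2) k * node_ratio (L div 2) (R div 2) k)"
proof -
  define l where "l = L - L div 2"
  define r where "r = R - R div 2"
  define l' where "l' = L div 2"
  define r' where "r' = R div 2"
  define I where "I = {- int l..int r}"
  define J where "J = {- int l'..int r'}"
  have ll: "l' \<le> l" "r' \<le> r" by (auto simp: l_def l'_def r_def r'_def)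
  have I: "finite I" "0 \<in> I" and J: "finite J" "0 \<in> J - {k}" "k \<in> J - {0}"
    using k by (auto simp: I_def J_def l'_def r'_def)
  define c where "c = fact (nat (int l + k)) * fact (nat (int r - k)) *
    (fact (nat (int l' + k)) * fact (nat (int r' - k)) :: real)"
  define d where "d = fact l * fact r * (fact l' * fact r' :: real)"
  define s where "s = (- 1 :: real) ^ (r + r')"
  \<comment> \<open>The signs at the nodes \<open>k\<close> and 0 agree, because the exponents
    differ by the even number \<open>2 * k\<close>.\<close>
  have "s = (- 1) ^ (nat (int r - k) + nat (int r' - k))"
  proof -
    have "even (nat (int r - k) + nat (int r' - k)) \<longleftrightarrow> even (int (nat (int r - k) + nat (int r' - k)))"
      by (simp only: even_of_nat)
    also have "int (nat (int r - k) + nat (int r' - k)) = int (r + r') - 2 * k"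
      using k ll by (simp add: r'_def)
    finally show ?thesis by (simp add: s_def minus_one_power_iff)
  qed
  then have "\<beta> k * (s * c) = \<beta> k * (poly (node_poly (I - {k})) (of_int k) * poly (node_poly (J - {k})) (of_int k))"
    using k ll unfolding I_def J_def
    by (subst (1 2) poly_node_poly_punctured) (auto simp: c_def power_add l'_def r'_def)
  also have "\<dots> = poly (pderiv (pderiv (node_poly I * node_poly (J - {k})))) 0"
    using nodal_coeff_node_poly[OF assms(1), of k] k
    by (simp add: I_def J_def l_def l'_def r_def r'_def)
  also have "\<dots> = 2 * (poly (pderiv (node_poly I)) 0 * poly (pderiv (node_poly (J - {k}))) 0)"
    using poly_node_poly_eq_0[OF I] poly_node_poly_eq_0[OF _ J(2)] J(1)
    by (simp add: pderiv_mult pderiv_add)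
  also have "\<dots> = 2 * (poly (node_poly (I - {0})) 0 * poly (node_poly (J - {k} - {0})) 0)"
    using poly_pderiv_node_poly_root[OF I] poly_pderiv_node_poly_root[OF _ J(2)] J(1) by simp
  finally have "\<beta> k * (s * c) * (- of_int k) =
      2 * (poly (node_poly (I - {0})) 0 * (- of_int k * poly (node_poly (J - {k} - {0})) 0))"
    by simp
  \<comment> \<open>The factor \<open>- k\<close> is the value at 0 of the linear factor with root
    \<open>k\<close>, which restores that root.\<close>
  also have "- of_int k * poly (node_poly (J - {k} - {0})) 0 = poly (node_poly (J - {0})) 0"
    using node_poly_remove[OF _ J(3)] J(1) by (simp add: Diff_insert2[symmetric] insert_commute)
  also have "2 * (poly (node_poly (I - {0})) 0 * poly (node_poly (J - {0})) 0) = s * (2 * d)"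
    unfolding I_def J_def poly_node_poly_punctured_0 by (simp add: s_def d_def power_add)
  finally have "s * (\<beta> k * c * (- of_int k)) = s * (2 * d)"
    by (simp add: mult_ac)
  moreover have "s \<noteq> 0" by (simp add: s_def)
  ultimately have "\<beta> k * c * (- of_int k) = 2 * d"
    by (metis mult_cancel_left)
  moreover have "c \<noteq> 0" by (simp add: c_def)
  ultimately have "\<beta> k = - 2 / of_int k * (d / c)"
    using k(1) by (simp add: field_simps)
  also have "d / c = node_ratio l r k * node_ratio l' r' k"
    by (simp add: c_def d_def node_ratio_def)
  finally show ?thesis by (simp add: l_def l'_def r_def r'_def)
qed

section \<open>The necessary condition in terms of factorials and harmonic numbers\<close>

text \<open>The closed formulas are inserted into
  \<open>\<beta> (- k) + \<beta> k \<le> 2 * \<beta> 0\<close>, with \<open>\<beta> k\<close>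
  estimated from below by \<open>- 2 / k\<close>; the result is multiplied by
  \<open>k / 2\<close>.\<close>

lemma node_ratio_mult_le_harm:
  assumes "order_accurate L R \<alpha> \<beta> (L + R)"
    and "\<And>t. 0 < t \<Longrightarrow> t \<le> pi \<Longrightarrow> Re (nodal_symbol L R \<beta> t) > 0"
    and "R \<le> L" and k: "0 < k" "k \<le> L div 2"
  shows "node_ratio (L - L div 2) (R - R div 2) (- int k) * node_ratio (L div 2) (R div 2) (- int k) - 1
    \<le> 2 * real k * (harm (L - L div 2) - harm (R - R div 2) + (harm (L div 2) - harm (R div 2)))"
    (is "?c - 1 \<le> 2 * real k * ?Z")
proof -
  have "\<beta> (- int k) = 2 / real k * ?c"
    using nodal_coeff_nonzero[OF assms(1), of "- int k"] k by simp
  moreover have "- 2 / real k \<le> (if int k \<le> nodal_width R then \<beta> (int k) else 0)"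
  proof (cases "k \<le> R div 2")
    case True
    have "node_ratio (L - L div 2) (R - R div 2) (int k) * node_ratio (L div 2) (R div 2) (int k) \<le> 1 * 1"
      using assms(3) True by (intro mult_mono node_ratio_le_1 node_ratio_nonneg) auto
    then have "2 / real k * (node_ratio (L - L div 2) (R - R div 2) (int k) *
        node_ratio (L div 2) (R div 2) (int k)) \<le> 2 / real k * 1"
      by (intro mult_left_mono) auto
    then show ?thesis
      using nodal_coeff_nonzero[OF assms(1), of "int k"] k True by (simp add: nodal_width_eq)
  qed (simp add: nodal_width_eq)
  moreover have "\<beta> (- int k) + (if int k \<le> nodal_width R then \<beta> (int k) else 0) \<le> 2 * \<beta> 0"
    using k by (intro nodal_symbol_pos_imp[OF assms(2)]) (auto simp: nodal_width_eq)
  ultimately have "2 / real k * ?c - 2 / real k \<le> 4 * ?Z"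
    using nodal_coeff_0[OF assms(1)] by linarith
  then show ?thesis
    using k by (simp add: field_simps)
qed

section \<open>The range \<open>L \<ge> 3 R + 7\<close>\<close>

lemma exp_half_power: "(13 / 8) ^ n \<le> exp (real n / 2)"
proof -
  have "13 / 8 \<le> exp (1 / 2 :: real)"
    using exp_lower_Taylor_quadratic[of "1 / 2 :: real"] by (simp add: power2_eq_square)
  then have "(13 / 8) ^ n \<le> exp (1 / 2 :: real) ^ n"
    by (intro power_mono) auto
  then show ?thesis by (simp add: exp_of_nat_mult[symmetric])
qed

text \<open>Each half of \<open>L\<close> is about three times the corresponding half of
  \<open>R\<close>; the parity cases check that the margin 7 absorbs the rounding.\<close>

lemma nine_mult_le_halves:
  fixes L R :: nat
  assumes "3 * R + 7 \<le> L"
  shows "9 * ((R - R div 2 + 1) * (R div 2 + 1)) \<le> (L - L div 2) * (L div 2)"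
proof -
  define r where "r = R div 2"
  define l where "l = L div 2"
  define f where "f = R mod 2"
  define e where "e = L mod 2"
  have R: "R = 2 * r + f" "f \<le> 1" "R - r = r + f"
    unfolding r_def f_def by presburger+
  have L: "L = 2 * l + e" "e \<le> 1" "L - l = l + e"
    unfolding l_def e_def by presburger+
  have "9 * ((r + f + 1) * (r + 1)) \<le> (l + e) * l"
  proof (cases "f = 0")
    case True
    show ?thesis
    proof (cases "e = 0")
      case e: True
      then have "(3 * r + 4) * (3 * r + 4) \<le> l * l" using assms L R True
        by (intro mult_le_mono) auto
      then show ?thesis using True e by (simp add: algebra_simps)
    next
      case False
      then have "(3 * r + 4) * (3 * r + 3) \<le> (l + e) * l" using assms L R True
        by (intro mult_le_mono) auto
      then show ?thesis using True by (simp add: algebra_simps)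
    qed
  next
    case False
    then have "f = 1" using R by simp
    moreover have "(3 * r + 5) * (3 * r + 5) \<le> (l + e) * l" using assms L R False
        by (intro mult_le_mono) auto
    ultimately show ?thesis by (simp add: algebra_simps)
  qed
  then show ?thesis by (simp only: r_def[symmetric] l_def[symmetric] R(3) L(3))
qed

text \<open>The product of quotients at \<open>k = 1\<close> is \<open>P\<close>, while the harmonic
  sum is at most \<open>ln P\<close> plus a constant. Linear growth wins from \<open>P = 9\<close>
  on.\<close>

lemma harm_less_node_ratio_1:
  fixes L R :: nat
  assumes "3 * R + 7 \<le> L"
  shows "2 * (harm (L - L div 2) - harm (R - R div 2) + (harm (L div 2) - harm (R div 2))) <
    node_ratio (L - L div 2) (R - R div 2) (- 1) * node_ratio (L div 2) (R div 2) (- 1) - 1"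
proof -
  define l where "l = L - L div 2"
  define r where "r = R - R div 2"
  define l' where "l' = L div 2"
  define r' where "r' = R div 2"
  have ge: "4 \<le> l" "3 \<le> l'" "r \<le> l" "r' \<le> l'"
    using assms by (auto simp: l_def r_def l'_def r'_def)
  define p where "p = real l / (real r + 1)"
  define p' where "p' = real l' / (real r' + 1)"
  define P where "P = p * p'"
  have "9 * ((r + 1) * (r' + 1)) \<le> l * l'"
    using nine_mult_le_halves[OF assms] by (simp only: l_def r_def l'_def r'_def)
  then have "real (9 * ((r + 1) * (r' + 1))) \<le> real (l * l')"
    by (simp only: of_nat_le_iff)
  then have "9 * ((real r + 1) * (real r' + 1)) \<le> real l * real l'"
    by (simp only: of_nat_mult of_nat_add of_nat_1 of_nat_numeral)
  then have P: "9 \<le> P"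
    unfolding P_def p_def p'_def times_divide_times_eq by (subst pos_le_divide_eq) auto
  \<comment> \<open>The constants 9/8 and, below, 7/6 come from \<open>l \<ge> 4\<close> and
    \<open>l' \<ge> 3\<close>.\<close>
  have "(real l + 1 / 2) / (real r + 1 / 2) \<le> 9 / 8 * real l / ((real r + 1) / 2)"
    using ge by (intro frac_le) auto
  moreover have "(real l' + 1 / 2) / (real r' + 1 / 2) \<le> 7 / 6 * real l' / ((real r' + 1) / 2)"
    using ge by (intro frac_le) auto
  moreover have "9 / 8 * x / ((y + 1) / 2) = 9 / 4 * (x / (y + 1))"
    "7 / 6 * x / ((y + 1) / 2) = 7 / 3 * (x / (y + 1))" for x y :: real
    by simp_all
  ultimately have "(real l + 1 / 2) / (real r + 1 / 2) * ((real l' + 1 / 2) / (real r' + 1 / 2)) \<le>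
      9 / 4 * p * (7 / 3 * p')"
    by (intro mult_mono) (auto simp: p_def p'_def)
  also have "\<dots> = 189 / 4 * (P / 9)"
    by (simp add: P_def)
  finally have X:
    "(real l + 1 / 2) / (real r + 1 / 2) * ((real l' + 1 / 2) / (real r' + 1 / 2)) \<le> 189 / 4 * (P / 9)" .
  have "harm l - harm r + (harm l' - harm r') \<le>
      ln ((real l + 1 / 2) / (real r + 1 / 2)) + ln ((real l' + 1 / 2) / (real r' + 1 / 2))"
    using ge by (intro add_mono harm_diff_le_ln)
  also have "\<dots> = ln ((real l + 1 / 2) / (real r + 1 / 2) * ((real l' + 1 / 2) / (real r' + 1 / 2)))"
    by (subst ln_mult) auto
  also have "\<dots> \<le> ln (189 / 4 * (P / 9))"
    using X P by (subst ln_le_cancel_iff) auto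
  also have "\<dots> = ln (189 / 4) + ln (P / 9)"
    using P by (subst ln_mult) auto
  \<comment> \<open>This is the tangent at \<open>P = 9\<close>. There the final comparison reads 8
    against 8, so strictness rests on \<open>ln (189 / 4) < 4\<close>.\<close>
  also have "ln (P / 9) \<le> P / 9 - 1"
    using P by (intro ln_le_minus_one) auto
  also have "ln (189 / 4 :: real) < 4"
  proof -
    have "189 / 4 < (13 / 8 :: real) ^ 8" by (simp add: power_divide)
    also have "\<dots> \<le> exp 4" using exp_half_power[of 8] by simp
    finally have "ln (189 / 4) < ln (exp 4 :: real)" by (subst ln_less_cancel_iff) auto
    then show ?thesis by simp
  qed
  finally have "2 * (harm l - harm r + (harm l' - harm r')) < P - 1"
    using P by simp
  moreover have "node_ratio l r (- 1) = p" "node_ratio l' r' (- 1) = p'"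
    using node_ratio_minus_Suc[of 0 l r] node_ratio_minus_Suc[of 0 l' r'] ge
    by (simp_all add: node_ratio_0 p_def p'_def)
  ultimately show ?thesis
    by (simp add: P_def l_def r_def l'_def r'_def)
qed

section \<open>The range where \<open>L - R\<close> is at most \<open>2 R + 7\<close>\<close>

text \<open>The left-hand side is at most linear in the exponent \<open>E\<close>, because
  \<open>D \<le> 2 R + 7\<close>; the exponential overtakes this linear function once
  \<open>E \<ge> 5\<close>, which follows from the quadratic hypothesis.\<close>

lemma exp_gt_rational:
  fixes D R :: real
  assumes D: "D \<le> 2 * R + 7" "24 \<le> D" and R: "9 \<le> R"
    and DR: "21 * R + 49 \<le> (D - 9)\<^sup>2"
  shows "D\<^sup>2 / (R + 1) < exp ((D\<^sup>2 - 9) / (2 * (D + 2 * R + 4))) - 1"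
proof -
  define E where "E = (D\<^sup>2 - 9) / (2 * (D + 2 * R + 4))"
  have "2 * (D + 2 * R + 4) \<noteq> 0"
    using D R by simp
  then have "E * (2 * (D + 2 * R + 4)) = D\<^sup>2 - 9"
    by (rule nonzero_eq_divide_eq[THEN iffD1]) (rule E_def)
  then have DE: "D\<^sup>2 = E * (2 * (D + 2 * R + 4)) + 9"
    by simp
  have "24 * D \<le> D * D" using D by simp
  then have "5 * (2 * (D + 2 * R + 4)) \<le> D\<^sup>2 - 9"
    using DR D R by (simp add: power2_eq_square algebra_simps)
  then have E: "5 \<le> E"
    using D R by (simp add: E_def pos_le_divide_eq)
  have "D\<^sup>2 \<le> E * (2 * (4 * R + 11)) + 9"
    unfolding DE using D E by (intro add_right_mono mult_left_mono) auto
  \<comment> \<open>Both constants, 47/10 and 9/10, are exact at \<open>R = 9\<close>.\<close>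
  also have "\<dots> \<le> E * (2 * (47 / 10 * (R + 1))) + 9 / 10 * (R + 1)"
    using R E by (intro add_mono mult_left_mono) auto
  also have "\<dots> = (47 / 5 * E + 9 / 10) * (R + 1)"
    by (simp add: algebra_simps)
  finally have "D\<^sup>2 / (R + 1) \<le> 47 / 5 * E + 9 / 10"
    using R by (simp add: pos_divide_le_eq)
  also have "\<dots> < 100 * (E - 4) - 1"
    using E by simp
  \<comment> \<open>Writing \<open>E = 5 + (E - 5)\<close> combines \<open>exp 5 \<ge> 100\<close>
    with the tangent of \<open>exp\<close> at 0.\<close>
  also have "100 * (E - 4) \<le> exp 5 * exp (E - 5)"
  proof (intro mult_mono)
    have "100 \<le> (13 / 8 :: real) ^ 10" by (simp add: power_divide)
    also have "\<dots> \<le> exp 5" using exp_half_power[of 10] by simp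
    finally show "100 \<le> exp (5 :: real)" .
    show "E - 4 \<le> exp (E - 5)" using exp_ge_add_one_self[of "E - 5"] by simp
  qed (use E in auto)
  also have "exp 5 * exp (E - 5) = exp E"
    by (simp flip: exp_add)
  finally show ?thesis by (simp add: E_def)
qed

text \<open>The Gaussian exponent is proportional to \<open>k * (D - 2 * k)\<close> after a common
  denominator is introduced; it peaks at \<open>D / 4\<close>, hence the choice of \<open>k\<close>.
  The harmonic side is at most \<open>D\<^sup>2 / (R + 1)\<close>.\<close>

lemma harm_less_node_ratio_quarter:
  fixes L R :: nat
  defines "D \<equiv> real L - real R"
  defines "k \<equiv> (L - R) div 4"
  assumes D: "D \<le> 2 * real R + 7" "24 \<le> D" and R: "9 \<le> R"
    and DR: "21 * real R + 49 \<le> (D - 9)\<^sup>2"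
  shows "2 * real k * (harm (L - L div 2) - harm (R - R div 2) + (harm (L div 2) - harm (R div 2))) <
    node_ratio (L - L div 2) (R - R div 2) (- int k) * node_ratio (L div 2) (R div 2) (- int k) - 1"
proof -
  define l where "l = L - L div 2"
  define r where "r = R - R div 2"
  define l' where "l' = L div 2"
  define r' where "r' = R div 2"
  have L: "R + 24 \<le> L" using D by (simp add: D_def)
  have k: "r + 2 * k \<le> l" "r' + 2 * k \<le> l'"
    using L unfolding l_def r_def l'_def r'_def k_def by linarith+
  have lr: "2 * (l + r) \<le> L + R + 2" "2 * (l' + r') \<le> L + R" "R \<le> 2 * r + 1" "R \<le> 2 * r' + 1"
    and sums: "l + l' = L" "r + r' = R"
    unfolding l_def r_def l'_def r'_def by presburger+
  have k4: "4 * k \<le> L - R" "L - R \<le> 4 * k + 3"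
    unfolding k_def by linarith+
  have kD: "4 * real k \<le> D" "D \<le> 4 * real k + 3"
    using k4 L unfolding D_def by linarith+
  have D_eq: "D = (real l - real r) + (real l' - real r')"
    unfolding D_def sums[symmetric] by simp
  let ?Z = "harm l - harm r + (harm l' - harm r') :: real"
  have "?Z \<le> (real l - real r) / (real r + 1) + (real l' - real r') / (real r' + 1)"
    using k by (intro add_mono harm_diff_le_divide) auto
  also have "\<dots> \<le> (real l - real r) / ((real R + 1) / 2) + (real l' - real r') / ((real R + 1) / 2)"
    using k lr by (intro add_mono divide_left_mono) auto
  also have "\<dots> = 2 * D / (real R + 1)"
    unfolding D_eq add_divide_distrib[symmetric] by simp
  finally have "2 * real k * ?Z \<le> D / 2 * (2 * D / (real R + 1))"
    using kD k by (intro mult_mono) (auto intro!: add_nonneg_nonneg harm_mono)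
  also have "\<dots> = D\<^sup>2 / (real R + 1)"
    by (simp add: power2_eq_square)
  also have "\<dots> < exp ((D\<^sup>2 - 9) / (2 * (D + 2 * real R + 4))) - 1"
    using assms by (intro exp_gt_rational) auto
  also have "exp ((D\<^sup>2 - 9) / (2 * (D + 2 * real R + 4))) \<le>
     exp (2 * real k * (real l - real r - real k) / (real l + real r + 1) +
       2 * real k * (real l' - real r' - real k) / (real l' + real r' + 1))"
  proof -
    \<comment> \<open>Rounding \<open>D / 4\<close> down costs at most 9, since
      \<open>8 k (D - 2 k) = D\<^sup>2 - (D - 4 k)\<^sup>2\<close>.\<close>
    have "(D - 4 * real k)\<^sup>2 \<le> 3\<^sup>2"
      using kD by (intro power_mono) auto
    then have "(D\<^sup>2 - 9) / (2 * (D + 2 * real R + 4)) \<le> 8 * (real k * (D - 2 * real k)) / (2 * (D + 2 * real R + 4))"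
      using D by (intro divide_right_mono) (auto simp: power2_eq_square algebra_simps)
    also have "\<dots> = 2 * real k * (real l - real r - real k) / ((real L + real R + 4) / 2) +
        2 * real k * (real l' - real r' - real k) / ((real L + real R + 4) / 2)"
    proof -
      have numer: "2 * real k * (real l - real r - real k) + 2 * real k * (real l' - real r' - real k) =
          2 * (real k * (D - 2 * real k))"
        unfolding D_eq by (simp add: algebra_simps)
      have denom: "D + 2 * real R + 4 = real L + real R + 4"
        by (simp add: D_def)
      have scale: "8 * x / (2 * s) = 2 * x / (s / 2)" for x s :: real
        by simp
      show ?thesis
        by (simp only: add_divide_distrib[symmetric] numer denom scale)
    qed
    \<comment> \<open>Both \<open>l + r + 1\<close> and \<open>l' + r' + 1\<close> are at most
      \<open>(L + R + 4) / 2\<close>.\<close>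
    also have "\<dots> \<le> 2 * real k * (real l - real r - real k) / (real l + real r + 1) +
       2 * real k * (real l' - real r' - real k) / (real l' + real r' + 1)"
      using k lr by (intro add_mono divide_left_mono mult_nonneg_nonneg mult_pos_pos) auto
    finally show ?thesis by simp
  qed
  also have "\<dots> \<le> node_ratio l r (- int k) * node_ratio l' r' (- int k)"
    unfolding exp_add using k by (intro mult_mono node_ratio_minus_ge_exp node_ratio_nonneg) auto
  finally show ?thesis
    by (simp add: l_def r_def l'_def r'_def)
qed

section \<open>Combination of the two ranges\<close>

theorem theorem3p1:
  fixes L R :: nat and \<alpha> \<beta> :: "int \<Rightarrow> real"
  assumes "L \<noteq> 0 \<or> R \<noteq> 0"
    and "order_accurate L R \<alpha> \<beta> (L + R)"
    and "\<And>\<theta>. 0 < \<theta> \<Longrightarrow> \<theta> \<le> pi \<Longrightarrow> Re (nodal_symbol L R \<beta> \<theta>) > 0"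
  shows "real L - real R < min (2 * real R + 7) (9 + sqrt (21 * real R + 49))"
proof (rule ccontr)
  assume neg: "\<not> ?thesis"
  have "sqrt 49 \<le> sqrt (21 * real R + 49)"
    by (intro real_sqrt_le_mono) simp
  then have sqrt: "7 \<le> sqrt (21 * real R + 49)"
    using real_sqrt_abs[of 7] by simp
  then have L: "R + 7 \<le> L"
    using neg by linarith
  have bound: "node_ratio (L - L div 2) (R - R div 2) (- int k) *
      node_ratio (L div 2) (R div 2) (- int k) - 1
      \<le> 2 * real k * (harm (L - L div 2) - harm (R - R div 2) + (harm (L div 2) - harm (R div 2)))"
    if "0 < k" "k \<le> L div 2" for k
    using L that by (intro node_ratio_mult_le_harm[OF assms(2,3)]) auto
  show False
  proof (cases "3 * R + 7 \<le> L")
    case True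
    have "1 \<le> L div 2"
      using L by presburger
    then show False
      using bound[OF zero_less_one] harm_less_node_ratio_1[OF True]
      unfolding of_nat_1 mult_1_right by (meson leD)
  next
    case False
    define D where "D = real L - real R"
    \<comment> \<open>Integrality turns \<open>L < 3 R + 7\<close> into a gap of 1, so the violated
      bound must be the one with the square root.\<close>
    have D: "D \<le> 2 * real R + 6"
      using False by (simp add: D_def)
    have D9: "sqrt (21 * real R + 49) \<le> D - 9"
      using neg D by (simp add: D_def min_def split: if_splits)
    have "(sqrt (21 * real R + 49))\<^sup>2 \<le> (D - 9)\<^sup>2"
      using D9 sqrt by (intro power_mono) auto
    then have DR: "21 * real R + 49 \<le> (D - 9)\<^sup>2"
      by simp
    \<comment> \<open>The upper and lower bounds on \<open>D - 9\<close> are compatible only if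
      \<open>4 R\<^sup>2 - 33 R \<ge> 40\<close>, which forces \<open>R \<ge> 9\<close>.\<close>
    have "(D - 9)\<^sup>2 \<le> (2 * real R - 3)\<^sup>2"
      using D D9 sqrt by (intro power_mono) auto
    then have "40 \<le> real R * (4 * real R - 33)"
      using DR by (simp add: power2_eq_square algebra_simps)
    then have "0 < 4 * real R - 33"
      by (smt (verit) mult_nonneg_nonpos of_nat_0_le_iff)
    then have R: "9 \<le> R"
      by linarith
    \<comment> \<open>At \<open>R = 9\<close> the value of \<open>21 R + 49\<close> is 238, which
      exceeds 225.\<close>
    then have "15\<^sup>2 \<le> (D - 9)\<^sup>2"
      using DR by simp
    then have D24: "24 \<le> D"
      using D9 sqrt by (subst (asm) power2_le_iff_abs_le) auto
    have "R + 24 \<le> L"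
      using D24 unfolding D_def by linarith
    then have k: "0 < (L - R) div 4" "(L - R) div 4 \<le> L div 2"
      by linarith+
    have D7: "D \<le> 2 * real R + 7"
      using D by linarith
    show False
      using leD[OF bound[OF k]]
        harm_less_node_ratio_quarter[OF D7[unfolded D_def] D24[unfolded D_def] R DR[unfolded D_def]]
      by (rule notE)
  qed
qed

end
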